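(* Let $p\in(1,\infty]$ and let $\Omega\subset\mathbb{R}^N$ be a domain with boundary $\Gamma$ satisfying $\Gamma=\partial(\mathbb{R}^N\setminus\overline{\Omega})$. For $\varepsilon>0$ let $u^\varepsilon$ be the bounded viscosity solution of $$u^\varepsilon-\varepsilon^2\Delta_p^Gu^\varepsilon=0\ \text{ in }\Omega,\qquad u^\varepsilon=1\ \text{ on }\Gamma.$$ Then $$\lim_{\varepsilon\to0^+}\varepsilon\log u^\varepsilon(x)=-\sqrt{p'}\,d_\Gamma(x)\quad\text{for any } x\in\overline{\Omega}.$$
   Context: $N\ge2$; a domain is a connected open set, not necessarily bounded, with nonempty boundary $\Gamma$; $d_\Gamma(x)=\inf\{|x-y|:y\in\Gamma\}$. $p'=p/(p-1)$ for $1<p<\infty$ and $p'=1$ for $p=\infty$. Game-theoretic $p$-laplacian: $\Delta_p^Gu=\frac1p\Delta u+\left(1-\frac2p\right)\frac{\langle\nabla^2u\,\nabla u,\nabla u\rangle}{|\nabla u|^2}$ (with $1/p=0$ if $p=\infty$), i.e. $\Delta_p^Gu=-F(\nabla u,\nabla^2u)$ where, for $\xi\in\mathbb{R}^N\setminus\{0\}$ and $X$ a symmetric $N\times N$ matrix, $F(\xi,X)=-\mathrm{tr}[A(\xi)X]$, $A(\xi)=\frac1pI+\left(1-\frac2p\right)\frac{\xi\otimes\xi}{|\xi|^2}$. The semicontinuous envelopes are $F_*(\xi,X)=\lim_{\delta\to0^+}\inf\{F(\eta,Y):\eta\ne0,|\eta-\xi|<\delta,|Y-X|<\delta\}$ and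 $F^*=-(-F)_*$. Viscosity solutions of $u-\varepsilon^2\Delta_p^Gu=0$ in $\Omega$: an upper semicontinuous $u$ is a subsolution if $u(x)+\varepsilon^2F_*(\nabla\phi(x),\nabla^2\phi(x))\le0$ whenever $\phi\in C^2(\Omega)$ and $u-\phi$ attains its maximum at $x$; a lower semicontinuous $v$ is a supersolution if $v(x)+\varepsilon^2F^*(\nabla\psi(x),\nabla^2\psi(x))\ge0$ whenever $\psi\in C^2(\Omega)$ and $v-\psi$ attains its minimum at $x$; a solution is both. Boundary values are attained continuously on $\Gamma$; the bounded viscosity solution of the problem is unique by comparison. *)

theory Defs
  imports "HOL-Analysis.Analysis"
begin

text \<open>The exponent is an extended real; \<open>1 / \<infinity> = 0\<close> holds in \<^typ>\<open>ereal\<close>.\<close>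

definition inv_exponent :: "ereal \<Rightarrow> real" where
  "inv_exponent p = real_of_ereal (1 / p)"

definition conj_exponent :: "ereal \<Rightarrow> real" where
  "conj_exponent p = (if p = \<infinity> then 1 else real_of_ereal p / (real_of_ereal p - 1))"

definition tensor_sq :: "real^'n \<Rightarrow> real^'n^'n" where
  "tensor_sq \<xi> = (\<chi> i j. \<xi> $ i * \<xi> $ j)"

definition pmatrix :: "ereal \<Rightarrow> real^'n \<Rightarrow> real^'n^'n" where
  "pmatrix p \<xi> =
     inv_exponent p *\<^sub>R mat 1
     + ((1 - 2 * inv_exponent p) / (norm \<xi>)\<^sup>2) *\<^sub>R tensor_sq \<xi>"

text \<open>The game-theoretic p-laplacian of \<open>u\<close> is \<open>- pF p (\<nabla>u) (\<nabla>\<^sup>2u)\<close>; only \<open>\<xi> \<noteq> 0\<close> is meaningful.\<close>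

definition pF :: "ereal \<Rightarrow> real^'n \<Rightarrow> real^'n^'n \<Rightarrow> real" where
  "pF p \<xi> X = - trace (pmatrix p \<xi> ** X)"

text \<open>The envelopes range over symmetric matrices; the norm on matrices is the Frobenius norm.
  For symmetric \<open>X\<close> (as every \<open>C\<^sup>2\<close> Hessian is), \<open>1 < p\<close>, and \<open>G\<close> one of \<open>pF p\<close>, \<open>- pF p\<close>, the sets below for \<open>\<delta> > 0\<close> are nonempty and bounded, because
  \<^const>\<open>pmatrix\<close> is bounded on nonzero vectors; the infima are nonincreasing in \<open>\<delta>\<close> and bounded,
  so the limit exists.\<close>

definition lower_envelope ::
    "(real^'n \<Rightarrow> real^'n^'n \<Rightarrow> real) \<Rightarrow> real^'n \<Rightarrow> real^'n^'n \<Rightarrow> real" where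
  "lower_envelope G \<xi> X =
     Lim (at_right 0) (\<lambda>\<delta>. Inf {G \<eta> Y | \<eta> Y. \<eta> \<noteq> 0 \<and> norm (\<eta> - \<xi>) < \<delta>
                                        \<and> transpose Y = Y \<and> norm (Y - X) < \<delta>})"

definition upper_envelope ::
    "(real^'n \<Rightarrow> real^'n^'n \<Rightarrow> real) \<Rightarrow> real^'n \<Rightarrow> real^'n^'n \<Rightarrow> real" where
  "upper_envelope G \<xi> X = - lower_envelope (\<lambda>\<eta> Y. - G \<eta> Y) \<xi> X"

text \<open>\<open>C2_with \<Omega> \<phi> g H\<close>: \<open>\<phi>\<close> is of class \<open>C\<^sup>2\<close> on the open set \<open>\<Omega>\<close>, with gradient \<open>g\<close> and
  Hessian \<open>H\<close> there.\<close>

definition C2_with ::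
    "(real^'n) set \<Rightarrow> (real^'n \<Rightarrow> real) \<Rightarrow> (real^'n \<Rightarrow> real^'n) \<Rightarrow> (real^'n \<Rightarrow> real^'n^'n) \<Rightarrow> bool" where
  "C2_with \<Omega> \<phi> g H \<longleftrightarrow>
     (\<forall>x\<in>\<Omega>. GDERIV \<phi> x :> g x) \<and>
     (\<forall>x\<in>\<Omega>. (g has_derivative (\<lambda>h. H x *v h)) (at x)) \<and>
     continuous_on \<Omega> H"

definition usc_on :: "'a::topological_space set \<Rightarrow> ('a \<Rightarrow> real) \<Rightarrow> bool" where
  "usc_on S u \<longleftrightarrow> (\<forall>x\<in>S. \<forall>c>u x. eventually (\<lambda>y. u y < c) (at x within S))"

definition lsc_on :: "'a::topological_space set \<Rightarrow> ('a \<Rightarrow> real) \<Rightarrow> bool" where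
  "lsc_on S u \<longleftrightarrow> (\<forall>x\<in>S. \<forall>c<u x. eventually (\<lambda>y. c < u y) (at x within S))"

definition visc_subsolution ::
    "ereal \<Rightarrow> real \<Rightarrow> (real^'n) set \<Rightarrow> (real^'n \<Rightarrow> real) \<Rightarrow> bool" where
  "visc_subsolution p \<epsilon> \<Omega> u \<longleftrightarrow>
     usc_on \<Omega> u \<and>
     (\<forall>\<phi> g H. C2_with \<Omega> \<phi> g H \<longrightarrow>
        (\<forall>x\<in>\<Omega>. (\<forall>y\<in>\<Omega>. u y - \<phi> y \<le> u x - \<phi> x) \<longrightarrow>
           u x + \<epsilon>\<^sup>2 * lower_envelope (pF p) (g x) (H x) \<le> 0))"

definition visc_supersolution ::
    "ereal \<Rightarrow> real \<Rightarrow> (real^'n) set \<Rightarrow> (real^'n \<Rightarrow> real) \<Rightarrow> bool" where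
  "visc_supersolution p \<epsilon> \<Omega> v \<longleftrightarrow>
     lsc_on \<Omega> v \<and>
     (\<forall>\<psi> g H. C2_with \<Omega> \<psi> g H \<longrightarrow>
        (\<forall>x\<in>\<Omega>. (\<forall>y\<in>\<Omega>. v x - \<psi> x \<le> v y - \<psi> y) \<longrightarrow>
           v x + \<epsilon>\<^sup>2 * upper_envelope (pF p) (g x) (H x) \<ge> 0))"

definition visc_solution ::
    "ereal \<Rightarrow> real \<Rightarrow> (real^'n) set \<Rightarrow> (real^'n \<Rightarrow> real) \<Rightarrow> bool" where
  "visc_solution p \<epsilon> \<Omega> u \<longleftrightarrow> visc_subsolution p \<epsilon> \<Omega> u \<and> visc_supersolution p \<epsilon> \<Omega> u"

text \<open>Only the values of \<open>u\<close> on \<open>closure \<Omega>\<close> matter: the boundary value 1 is both the value on the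
  boundary and the limit from inside.\<close>

definition bounded_visc_solution ::
    "ereal \<Rightarrow> real \<Rightarrow> (real^'n) set \<Rightarrow> (real^'n \<Rightarrow> real) \<Rightarrow> bool" where
  "bounded_visc_solution p \<epsilon> \<Omega> u \<longleftrightarrow>
     bounded (u ` \<Omega>) \<and>
     visc_solution p \<epsilon> \<Omega> u \<and>
     (\<forall>y\<in>frontier \<Omega>. u y = 1 \<and> (u \<longlongrightarrow> 1) (at y within \<Omega>))"

end

theory Submission
  imports Defs
begin

text \<open>The solution is trapped between two explicit exponential profiles with rate
\<open>\<surd>p' / \<epsilon>\<close>, where \<open>p'\<close> is the conjugate exponent. On a radial function \<open>f (|y - a|\<^sup>2)\<close> the
operator is linear, \<open>2 f' \<tau> + 4 f'' s (1 - 1/p)\<close> with \<open>s = |y - a|\<^sup>2\<close> and \<open>\<tau> = 1 + (N - 2) / p\<close>,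
and this remains true at the center, where the gradient vanishes: there the Hessian is
a multiple of the identity and both envelopes agree. For \<open>exp (k |y - a|)\<close> the dominant term is
\<open>(1 - 1/p) k\<^sup>2 = k\<^sup>2 / p'\<close>, and the remaining ones are \<open>O(k)\<close> away from the center. Hence
\<open>\<epsilon> k\<close> slightly below \<open>\<surd>p'\<close> makes it a supersolution, and slightly above \<open>\<surd>p'\<close> makes
\<open>exp (- k |y - a|)\<close> a subsolution, once \<open>\<epsilon>\<close> is small.

Upper bound (\<open>solution_le_exponential\<close>): centered at the point \<open>x\<close> itself, with \<open>|y - x|\<close> smoothed to
\<open>\<surd>(|y - x|\<^sup>2 + \<delta>\<^sup>2)\<close> and scaled to the value 1 at distance \<open>d\<close>, the distance of \<open>x\<close> to the boundary,
the growing profile is at least 1 on the whole boundary and blows up at infinity.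
Lower bound (\<open>exponential_le_solution\<close>): the hypothesis on the boundary supplies a ball \<open>ball a \<rho>\<close>
outside the closure of the domain whose center is as close as desired to a boundary point nearest
to \<open>x\<close>; the profile \<open>exp (- k (|y - a| - \<rho>))\<close> is at most 1 on the boundary, tends to 0 at infinity, and is smooth on the
domain.

As both profiles are classical, comparison is direct: they serve as test functions, the difference
with the solution attaining its maximum over the domain
(\<open>subsolution_le_smooth_supersolution\<close>). Taking \<open>\<epsilon> log\<close> of the two bounds and letting first \<open>\<epsilon>\<close> and
then the auxiliary parameter \<open>t\<close> tend to 0 gives the limit.\<close>

section \<open>Envelopes of the operator on radial Hessians\<close>

text \<open>The Lipschitz bound reduces the limit in both variables to a limit in the gradient variable alone.\<close>

lemma lower_envelope_eqI:
  fixes G :: "real^'n \<Rightarrow> real^'n^'n \<Rightarrow> real"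
  assumes sym: "transpose X = X"
    and lim: "\<And>e. e > 0 \<Longrightarrow> \<exists>d>0. \<forall>\<eta>. \<eta> \<noteq> 0 \<longrightarrow> norm (\<eta> - \<xi>) < d \<longrightarrow> \<bar>G \<eta> X - L\<bar> \<le> e"
    and lip: "\<And>\<eta> Y. \<eta> \<noteq> 0 \<Longrightarrow> \<bar>G \<eta> Y - G \<eta> X\<bar> \<le> K * norm (Y - X)"
  shows "lower_envelope G \<xi> X = L"
proof -
  let ?S = "\<lambda>\<delta>. {G \<eta> Y | \<eta> Y. \<eta> \<noteq> 0 \<and> norm (\<eta> - \<xi>) < \<delta> \<and> transpose Y = Y \<and> norm (Y - X) < \<delta>}"
  have "((\<lambda>\<delta>. Inf (?S \<delta>)) \<longlongrightarrow> L) (at_right 0)"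
  proof (rule tendstoI)
    fix e :: real assume e: "e > 0"
    obtain d where d: "d > 0" "\<And>\<eta>. \<eta> \<noteq> 0 \<Longrightarrow> norm (\<eta> - \<xi>) < d \<Longrightarrow> \<bar>G \<eta> X - L\<bar> \<le> e/3"
      using lim[of "e/3"] e by auto
    define d' where "d' = min d (e / (3 * (\<bar>K\<bar> + 1)))"
    have "d' > 0" using d e by (simp add: d'_def)
    moreover have "dist (Inf (?S \<delta>)) L < e" if \<delta>: "0 < \<delta>" "\<delta> < d'" for \<delta>
    proof -
      \<comment> \<open>At \<open>\<xi> = 0\<close> a nonzero vector is needed for the infimum to range over a nonempty set.\<close>
      obtain v :: "real^'n" where "v \<noteq> 0" "norm v < \<delta>"
      proof -
        obtain v :: "real^'n" where "norm v = \<delta>/2"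
          using vector_choose_size[of "\<delta>/2"] \<delta>(1) by auto
        then show thesis using \<delta>(1) by (intro that[of v]) auto
      qed
      then have "\<exists>\<eta>. \<eta> \<noteq> 0 \<and> norm (\<eta> - \<xi>) < \<delta>"
        using \<delta>(1) by (cases "\<xi> = 0") (auto intro: exI[of _ v] exI[of _ \<xi>])
      then have ne: "?S \<delta> \<noteq> {}"
        using sym \<delta>(1) by (auto intro!: exI[of _ X])
      have "\<bar>x - L\<bar> \<le> 2*e/3" if x_in: "x \<in> ?S \<delta>" for x
      proof -
        obtain \<eta> Y where x: "x = G \<eta> Y" "\<eta> \<noteq> 0" "norm (\<eta> - \<xi>) < \<delta>" "norm (Y - X) < \<delta>"
          using x_in by blast
        have "\<bar>G \<eta> Y - G \<eta> X\<bar> \<le> K * norm (Y - X)" using lip x by auto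
        also have "\<dots> \<le> (\<bar>K\<bar> + 1) * (e / (3 * (\<bar>K\<bar> + 1)))"
          using x(4) \<delta>(2) by (intro mult_mono) (auto simp: d'_def)
        also have "\<dots> = e/3" by (simp add: field_simps)
        finally have "\<bar>G \<eta> Y - G \<eta> X\<bar> \<le> e/3" .
        moreover have "\<bar>G \<eta> X - L\<bar> \<le> e/3" using d(2)[OF x(2)] x(3) \<delta>(2) by (simp add: d'_def)
        ultimately show ?thesis unfolding x(1) by linarith
      qed
      then have "\<bar>Inf (?S \<delta>) - L\<bar> \<le> 2*e/3" by (intro cInf_asclose[OF ne] ballI)
      then show ?thesis using e by (simp add: dist_real_def)
    qed
    ultimately show "eventually (\<lambda>\<delta>. dist (Inf (?S \<delta>)) L < e) (at_right 0)"
      unfolding eventually_at_right_field by blast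
  qed
  then show ?thesis unfolding lower_envelope_def
    by (intro tendsto_Lim) auto
qed

text \<open>The operator is even in the gradient and odd in the Hessian; this turns statements about
supersolutions into statements about subsolutions.\<close>

lemma lower_envelope_pF_minus:
  "lower_envelope (\<lambda>\<eta> Y. - pF p \<eta> Y) (-\<xi>) (-X) = lower_envelope (pF p) \<xi> X"
proof -
  have odd: "pF p (-\<eta>) (-Y) = - pF p \<eta> Y" for \<eta> :: "real^'n" and Y
  proof -
    have "pmatrix p (-\<eta>) = pmatrix p \<eta>" by (simp add: pmatrix_def tensor_sq_def)
    moreover have "pmatrix p \<eta> ** (-Y) = - (pmatrix p \<eta> ** Y)"
      by (simp add: matrix_matrix_mult_def vec_eq_iff sum_negf)
    ultimately show ?thesis by (simp add: pF_def trace_def sum_negf)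
  qed
  have tr: "transpose (-Y) = - transpose Y" for Y :: "real^'n^'n"
    by (simp add: transpose_def vec_eq_iff)
  have "{- pF p \<eta> Y |\<eta> Y. \<eta> \<noteq> 0 \<and> norm (\<eta> - - \<xi>) < \<delta> \<and> transpose Y = Y \<and> norm (Y - - X) < \<delta>}
      = {pF p \<eta> Y |\<eta> Y. \<eta> \<noteq> 0 \<and> norm (\<eta> - \<xi>) < \<delta> \<and> transpose Y = Y \<and> norm (Y - X) < \<delta>}"
    (is "?A = ?B") for \<delta>
  proof -
    have n: "norm (-\<eta> - - \<xi>) = norm (\<eta> - \<xi>)" "norm (-\<eta> - \<xi>) = norm (\<eta> - - \<xi>)"
      for \<eta> \<xi> :: "'z::real_normed_vector"
      using norm_minus_commute[of \<xi> \<eta>] norm_minus_cancel[of "\<eta> + \<xi>"] by (auto simp: algebra_simps)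
    show ?thesis
    proof (intro set_eqI iffI)
      fix x assume "x \<in> ?A"
      then obtain \<eta> Y where h: "x = - pF p \<eta> Y" "\<eta> \<noteq> 0" "norm (\<eta> - - \<xi>) < \<delta>" "transpose Y = Y" "norm (Y - - X) < \<delta>"
        by blast
      show "x \<in> ?B"
        using h by (intro CollectI exI[of _ "-\<eta>"] exI[of _ "-Y"]) (simp only: odd tr n, simp)
    next
      fix x assume "x \<in> ?B"
      then obtain \<eta> Y where h: "x = pF p \<eta> Y" "\<eta> \<noteq> 0" "norm (\<eta> - \<xi>) < \<delta>" "transpose Y = Y" "norm (Y - X) < \<delta>"
        by blast
      show "x \<in> ?A"
        using h by (intro CollectI exI[of _ "-\<eta>"] exI[of _ "-Y"]) (simp only: odd tr n, simp)
    qed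
  qed
  then show ?thesis by (simp only: lower_envelope_def)
qed

lemma trace_matrix_mul: "trace (A ** B) = (\<Sum>i\<in>UNIV. \<Sum>j\<in>UNIV. A $ i $ j * B $ j $ i)"
  for A B :: "real^'n^'n"
  by (simp add: trace_def matrix_matrix_mult_def)

lemma matrix_add_rdistrib: "(A + B) ** C = A ** C + B ** C"
  by (vector matrix_matrix_mult_def sum.distrib[symmetric] field_simps)

text \<open>The trace of \<open>pmatrix p \<xi>\<close> in dimension \<open>N\<close>, the same for every \<open>\<xi> \<noteq> 0\<close>.\<close>

definition pmatrix_trace :: "ereal \<Rightarrow> nat \<Rightarrow> real" where
  "pmatrix_trace p N = 1 + (real N - 2) * inv_exponent p"

lemma pF_radial:
  fixes \<eta> w :: "real^'n"
  assumes "\<eta> \<noteq> 0"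
  shows "pF p \<eta> (a *\<^sub>R mat 1 + b *\<^sub>R tensor_sq w) =
    - (inv_exponent p * (a * CARD('n) + b * (w \<bullet> w))
       + (1 - 2 * inv_exponent p) * (a + b * (\<eta> \<bullet> w)\<^sup>2 / (\<eta> \<bullet> \<eta>)))"
proof -
  define c where "c = (1 - 2 * inv_exponent p) / (norm \<eta>)\<^sup>2"
  let ?X = "a *\<^sub>R mat 1 + b *\<^sub>R tensor_sq w"
  have tr: "trace ?X = a * CARD('n) + b * (w \<bullet> w)"
    by (simp add: trace_def mat_def tensor_sq_def inner_vec_def sum.distrib sum_distrib_left)
  have "trace (tensor_sq \<eta> ** ?X) = (\<Sum>i\<in>UNIV. \<Sum>j\<in>UNIV. \<eta> $ i * \<eta> $ j * (a * (if j = i then 1 else 0) + b * (w $ j * w $ i)))"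
    by (simp add: trace_matrix_mul mat_def tensor_sq_def)
  also have "\<dots> = (\<Sum>i\<in>UNIV. \<Sum>j\<in>UNIV. (if j = i then a * (\<eta> $ i * \<eta> $ i) else 0) + b * ((\<eta> $ i * w $ i) * (\<eta> $ j * w $ j)))"
    by (intro sum.cong refl) (auto simp: algebra_simps)
  also have "\<dots> = a * (\<eta> \<bullet> \<eta>) + b * (\<Sum>i\<in>UNIV. \<Sum>j\<in>UNIV. (\<eta> $ i * w $ i) * (\<eta> $ j * w $ j))"
    by (simp add: sum.distrib inner_vec_def sum_distrib_left)
  also have "\<dots> = a * (\<eta> \<bullet> \<eta>) + b * (\<eta> \<bullet> w)\<^sup>2"
    unfolding sum_product[symmetric] by (simp add: inner_vec_def power2_eq_square)
  finally have te: "trace (tensor_sq \<eta> ** ?X) = a * (\<eta> \<bullet> \<eta>) + b * (\<eta> \<bullet> w)\<^sup>2" .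
  have "trace (pmatrix p \<eta> ** ?X) = inv_exponent p * trace ?X + c * trace (tensor_sq \<eta> ** ?X)"
  proof -
    have "pmatrix p \<eta> ** ?X = inv_exponent p *\<^sub>R ?X + c *\<^sub>R (tensor_sq \<eta> ** ?X)"
      unfolding pmatrix_def c_def[symmetric]
      by (simp only: matrix_add_rdistrib scalar_matrix_assoc[symmetric] matrix_mul_lid)
    moreover have "trace (r *\<^sub>R A) = r * trace A" for r and A :: "real^'n^'n"
      by (simp add: trace_def sum_distrib_left)
    ultimately show ?thesis by (simp only: trace_add)
  qed
  then show ?thesis
    using assms unfolding pF_def te tr c_def by (simp add: power2_norm_eq_inner field_simps)
qed

lemma pF_lipschitz:
  fixes \<eta> :: "real^'n"
  assumes "\<eta> \<noteq> 0"
  shows "\<bar>pF p \<eta> Y - pF p \<eta> X\<bar>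
    \<le> (real CARD('n))\<^sup>2 * (\<bar>inv_exponent p\<bar> + \<bar>1 - 2 * inv_exponent p\<bar>) * norm (Y - X)"
proof -
  let ?B = "\<bar>inv_exponent p\<bar> + \<bar>1 - 2 * inv_exponent p\<bar>"
  have A: "\<bar>pmatrix p \<eta> $ i $ j\<bar> \<le> ?B" for i j
  proof -
    have "\<bar>\<eta> $ i * \<eta> $ j\<bar> \<le> (norm \<eta>)\<^sup>2"
      unfolding power2_eq_square abs_mult by (intro mult_mono component_le_norm_cart) auto
    then have "\<bar>\<eta> $ i * \<eta> $ j\<bar> / (norm \<eta>)\<^sup>2 \<le> 1" using assms by simp
    then have "\<bar>1 - 2 * inv_exponent p\<bar> * (\<bar>\<eta> $ i * \<eta> $ j\<bar> / (norm \<eta>)\<^sup>2) \<le> \<bar>1 - 2 * inv_exponent p\<bar> * 1"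
      by (intro mult_left_mono) auto
    moreover have "\<bar>inv_exponent p * (if i = j then 1 else 0)\<bar> \<le> \<bar>inv_exponent p\<bar>" by auto
    moreover have "pmatrix p \<eta> $ i $ j = inv_exponent p * (if i = j then 1 else 0)
        + (1 - 2 * inv_exponent p) * (\<eta> $ i * \<eta> $ j / (norm \<eta>)\<^sup>2)"
      by (simp add: pmatrix_def mat_def tensor_sq_def)
    moreover have "\<bar>(1 - 2 * inv_exponent p) * (\<eta> $ i * \<eta> $ j / (norm \<eta>)\<^sup>2)\<bar>
        = \<bar>1 - 2 * inv_exponent p\<bar> * (\<bar>\<eta> $ i * \<eta> $ j\<bar> / (norm \<eta>)\<^sup>2)"
      by (simp only: abs_mult abs_divide abs_power2 abs_norm_cancel power_abs)
    moreover have "\<bar>x + y\<bar> \<le> A + B" if "\<bar>x\<bar> \<le> A" "\<bar>y\<bar> \<le> B" for x y A B :: real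
      using that by linarith
    ultimately show ?thesis by (metis mult.right_neutral)
  qed
  have "pF p \<eta> Y - pF p \<eta> X = - (\<Sum>i\<in>UNIV. \<Sum>j\<in>UNIV. pmatrix p \<eta> $ i $ j * (Y - X) $ j $ i)"
    unfolding pF_def trace_matrix_mul by (simp add: algebra_simps sum_subtractf)
  also have "\<bar>\<dots>\<bar> \<le> (\<Sum>i\<in>UNIV. \<Sum>j\<in>UNIV. \<bar>pmatrix p \<eta> $ i $ j * (Y - X) $ j $ i\<bar>)"
    unfolding abs_minus_cancel by (intro order_trans[OF sum_abs] sum_mono) auto
  also have "\<dots> \<le> (\<Sum>i\<in>(UNIV::'n set). \<Sum>j\<in>(UNIV::'n set). ?B * norm (Y - X))"
  proof (intro sum_mono)
    fix i j
    have "\<bar>(Y - X) $ j $ i\<bar> \<le> norm (Y - X)"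
      using component_le_norm_cart[of "(Y-X) $ j" i] Finite_Cartesian_Product.norm_nth_le[of "Y - X" j] by linarith
    then show "\<bar>pmatrix p \<eta> $ i $ j * (Y - X) $ j $ i\<bar> \<le> ?B * norm (Y - X)"
      unfolding abs_mult by (intro mult_mono A) auto
  qed
  also have "\<dots> = (real CARD('n))\<^sup>2 * ?B * norm (Y - X)"
    by (simp add: power2_eq_square)
  finally show ?thesis .
qed

text \<open>The gradient and Hessian of a radial function have this form with \<open>w = y - a\<close>. For \<open>w \<noteq> 0\<close> the
operator is continuous at \<open>c *\<^sub>R w\<close>. For \<open>w = 0\<close> the Hessian is \<open>a *\<^sub>R mat 1\<close>, on which the operator does not
depend on the direction of the gradient, so its discontinuity at 0 is invisible. The factor \<open>c\<close> must not vanish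
because a zero gradient together with \<open>w \<noteq> 0\<close> would bring the discontinuity back.\<close>

lemma lower_envelope_radial:
  fixes w :: "real^'n"
  assumes "c \<noteq> 0"
  shows "lower_envelope (pF p) (c *\<^sub>R w) (a *\<^sub>R mat 1 + b *\<^sub>R tensor_sq w) =
    - (a * pmatrix_trace p CARD('n) + b * (w \<bullet> w) * (1 - inv_exponent p))"
    (is "_ = ?L")
proof (rule lower_envelope_eqI)
  let ?X = "a *\<^sub>R mat 1 + b *\<^sub>R tensor_sq w :: real^'n^'n"
  show "transpose ?X = ?X"
    by (simp add: transpose_def mat_def tensor_sq_def vec_eq_iff mult.commute)
  show "\<bar>pF p \<eta> Y - pF p \<eta> ?X\<bar> \<le> ((real CARD('n))\<^sup>2 * (\<bar>inv_exponent p\<bar> + \<bar>1 - 2 * inv_exponent p\<bar>)) * norm (Y - ?X)"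
    if "\<eta> \<noteq> 0" for \<eta> Y using pF_lipschitz[OF that] .
  fix e :: real assume e: "e > 0"
  show "\<exists>d>0. \<forall>\<eta>. \<eta> \<noteq> 0 \<longrightarrow> norm (\<eta> - c *\<^sub>R w) < d \<longrightarrow> \<bar>pF p \<eta> ?X - ?L\<bar> \<le> e"
  proof (cases "w = 0")
    case True
    then show ?thesis using e
      by (intro exI[of _ 1]) (auto simp: pF_radial pmatrix_trace_def algebra_simps)
  next
    case False
    define f where "f = (\<lambda>\<eta>. - (inv_exponent p * (a * CARD('n) + b * (w \<bullet> w))
       + (1 - 2 * inv_exponent p) * (a + b * (\<eta> \<bullet> w)\<^sup>2 / (\<eta> \<bullet> \<eta>))))"
    have fL: "f (c *\<^sub>R w) = ?L"
      using False assms by (simp add: f_def pmatrix_trace_def power2_eq_square) (simp add: algebra_simps)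
    have "isCont f (c *\<^sub>R w)"
      unfolding f_def using False assms by (intro continuous_intros) auto
    then obtain d where d: "d > 0" "\<And>\<eta>. dist \<eta> (c *\<^sub>R w) < d \<Longrightarrow> dist (f \<eta>) (f (c *\<^sub>R w)) < e"
      using e unfolding continuous_at_eps_delta by blast
    show ?thesis
    proof (intro exI[of _ d] conjI allI impI)
      fix \<eta> assume "\<eta> \<noteq> 0" "norm (\<eta> - c *\<^sub>R w) < d"
      then have "dist (f \<eta>) ?L < e" using d(2) fL by (simp add: dist_norm)
      moreover have "pF p \<eta> ?X = f \<eta>" using \<open>\<eta> \<noteq> 0\<close> by (simp add: pF_radial f_def)
      ultimately show "\<bar>pF p \<eta> ?X - ?L\<bar> \<le> e" by (simp add: dist_real_def)
    qed (rule d)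
  qed
qed

lemma tensor_sq_mul_vec: "tensor_sq w *v h = (w \<bullet> h) *\<^sub>R w"
  by (simp add: vec_eq_iff matrix_vector_mult_def tensor_sq_def inner_vec_def sum_distrib_left mult_ac)

text \<open>Radial functions are written in terms of \<open>|y - a|\<^sup>2\<close> instead of \<open>|y - a|\<close>, so that smoothness of the
profile gives smoothness at the center as well.\<close>

lemma C2_with_radial:
  fixes a :: "real^'n" and f :: "real \<Rightarrow> real"
  assumes "\<And>y. y \<in> \<Omega> \<Longrightarrow> (f has_real_derivative f1 ((y - a) \<bullet> (y - a))) (at ((y - a) \<bullet> (y - a)))"
    and "\<And>y. y \<in> \<Omega> \<Longrightarrow> (f1 has_real_derivative f2 ((y - a) \<bullet> (y - a))) (at ((y - a) \<bullet> (y - a)))"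
    and "continuous_on \<Omega> (\<lambda>y. f2 ((y - a) \<bullet> (y - a)))"
  shows "C2_with \<Omega> (\<lambda>y. f ((y - a) \<bullet> (y - a)))
    (\<lambda>y. (2 * f1 ((y - a) \<bullet> (y - a))) *\<^sub>R (y - a))
    (\<lambda>y. (2 * f1 ((y - a) \<bullet> (y - a))) *\<^sub>R mat 1 + (4 * f2 ((y - a) \<bullet> (y - a))) *\<^sub>R tensor_sq (y - a))"
  unfolding C2_with_def
proof (intro conjI ballI)
  let ?s = "\<lambda>y. (y - a) \<bullet> (y - a)"
  have s: "(?s has_derivative (\<lambda>h. 2 * ((y - a) \<bullet> h))) (at y)" for y
    by (auto intro!: derivative_eq_intros simp: inner_commute)
  fix y assume y: "y \<in> \<Omega>"
  show "GDERIV (\<lambda>y. f (?s y)) y :> (2 * f1 (?s y)) *\<^sub>R (y - a)"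
    using has_derivative_compose[OF s assms(1)[OF y, unfolded has_field_derivative_def]]
    by (simp add: gderiv_def inner_commute mult_ac)
  have f1: "((\<lambda>y. f1 (?s y)) has_derivative (\<lambda>h. f2 (?s y) * (2 * ((y - a) \<bullet> h)))) (at y)"
    using has_derivative_compose[OF s assms(2)[OF y, unfolded has_field_derivative_def]] .
  show "((\<lambda>y. (2 * f1 (?s y)) *\<^sub>R (y - a)) has_derivative
     (\<lambda>h. ((2 * f1 (?s y)) *\<^sub>R mat 1 + (4 * f2 (?s y)) *\<^sub>R tensor_sq (y - a)) *v h)) (at y)"
    by (rule derivative_eq_intros f1 refl)+
      (simp add: matrix_vector_mult_add_rdistrib scaleR_matrix_vector_assoc[symmetric] tensor_sq_mul_vec fun_eq_iff)
next
  let ?s = "\<lambda>y. (y - a) \<bullet> (y - a)"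
  have "continuous_on \<Omega> (\<lambda>y. f1 (?s y))"
  proof (rule continuous_at_imp_continuous_on, rule ballI)
    fix y assume "y \<in> \<Omega>"
    then have "isCont f1 (?s y)" using assms(2) DERIV_isCont by blast
    then show "isCont (\<lambda>y. f1 (?s y)) y"
      by (intro isCont_o2[of y ?s f1]) (auto intro!: continuous_intros)
  qed
  moreover have "continuous_on \<Omega> (\<lambda>y. tensor_sq (y - a))"
    unfolding tensor_sq_def by (intro continuous_intros)
  ultimately show "continuous_on \<Omega> (\<lambda>y. (2 * f1 (?s y)) *\<^sub>R mat 1 + (4 * f2 (?s y)) *\<^sub>R tensor_sq (y - a))"
    by (intro continuous_intros assms(3))
qed

section \<open>Comparison with smooth supersolutions\<close>

text \<open>Were \<open>w\<close> above \<open>\<phi>\<close> somewhere, the superlevel sets of \<open>w - \<phi>\<close> at positive levels would be compact: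
bounded because \<open>\<phi> \<ge> M \<ge> w\<close> far away, and closed because \<open>w - \<phi>\<close> is upper semicontinuous with limits
\<open>\<le> 0\<close> at the boundary. So \<open>w - \<phi>\<close> would attain its maximum over \<open>\<Omega>\<close> at some \<open>x\<close>, and the definition of a
subsolution with test function \<open>\<phi>\<close> would contradict the supersolution inequality at \<open>x\<close>, as
\<open>w x > \<phi> x\<close>.\<close>

lemma subsolution_le_smooth_supersolution:
  fixes w \<phi> :: "real^'n \<Rightarrow> real"
  assumes "open \<Omega>" and sub: "visc_subsolution p \<epsilon> \<Omega> w"
    and bdy: "\<And>y. y \<in> frontier \<Omega> \<Longrightarrow> (w \<longlongrightarrow> b) (at y within \<Omega>)"
    and upper: "\<And>y. y \<in> \<Omega> \<Longrightarrow> w y \<le> M"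
    and C2: "C2_with \<Omega> \<phi> g H" and cont: "continuous_on (closure \<Omega>) \<phi>"
    and \<phi>_bdy: "\<And>y. y \<in> frontier \<Omega> \<Longrightarrow> b \<le> \<phi> y"
    and far: "bounded {y\<in>\<Omega>. \<phi> y < M}"
    and super: "\<And>y. y \<in> \<Omega> \<Longrightarrow> 0 \<le> \<phi> y + \<epsilon>\<^sup>2 * lower_envelope (pF p) (g y) (H y)"
    and "z \<in> \<Omega>"
  shows "w z \<le> \<phi> z"
proof (rule ccontr)
  assume neg: "\<not> w z \<le> \<phi> z"
  define h where "h y = w y - \<phi> y" for y
  have hz: "h z > 0" using neg by (simp add: h_def)
  define S where "S t = {y\<in>\<Omega>. t \<le> h y}" for t
  have compS: "compact (S t)" if t: "t > 0" for t
  proof -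
    have "S t \<subseteq> {y\<in>\<Omega>. \<phi> y < M}" using upper t by (fastforce simp: S_def h_def)
    then have "bounded (S t)" using far bounded_subset by blast
    moreover have "closed (S t)"
      unfolding closed_limpt
    proof (intro allI impI)
      fix l assume l: "l islimpt S t"
      then have cl: "l \<in> closure \<Omega>"
        by (metis (no_types, lifting) S_def closure_def islimpt_subset mem_Collect_eq subsetI UnI2)
      have \<phi>lim: "(\<phi> \<longlongrightarrow> \<phi> l) (at l within \<Omega>)"
        using cont cl by (meson closure_subset continuous_on_def tendsto_within_subset)
      have nbot: "at l within S t \<noteq> bot" using l trivial_limit_within by blast
      have False if "eventually (\<lambda>y. h y < t) (at l within \<Omega>)"
      proof -
        have "eventually (\<lambda>y. h y < t) (at l within S t)"
          using filter_leD[OF at_le that] by (simp add: S_def)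
        moreover have "eventually (\<lambda>y. y \<in> S t) (at l within S t)"
          by (simp add: eventually_at_filter)
        ultimately have "eventually (\<lambda>y. False) (at l within S t)"
          by eventually_elim (auto simp: S_def)
        then show False using nbot by simp
      qed note contra = this
      have "l \<in> \<Omega>"
      proof (rule ccontr)
        assume "l \<notin> \<Omega>"
        then have fr: "l \<in> frontier \<Omega>" using cl \<open>open \<Omega>\<close> by (simp add: frontier_def interior_open)
        have "(h \<longlongrightarrow> b - \<phi> l) (at l within \<Omega>)"
          unfolding h_def by (intro tendsto_diff bdy fr \<phi>lim)
        moreover have "b - \<phi> l < t" using \<phi>_bdy[OF fr] t by linarith
        ultimately show False using contra order_tendstoD(2) by blast
      qed
      moreover have "t \<le> h l"
      proof (rule ccontr)
        assume lt: "\<not> t \<le> h l"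
        define m where "m = (t - h l) / 2"
        have m: "m > 0" "w l + m - (\<phi> l - m) = t" using lt by (auto simp: m_def h_def field_simps)
        have "\<forall>\<^sub>F y in at l within \<Omega>. w y < w l + m"
          using sub \<open>l \<in> \<Omega>\<close> m(1) unfolding visc_subsolution_def usc_on_def by simp
        moreover have "\<forall>\<^sub>F y in at l within \<Omega>. \<phi> l - m < \<phi> y"
          using \<phi>lim m(1) by (intro order_tendstoD(1)) auto
        ultimately have "\<forall>\<^sub>F y in at l within \<Omega>. h y < t"
          by eventually_elim (use m(2) in \<open>auto simp: h_def\<close>)
        then show False by (rule contra)
      qed
      ultimately show "l \<in> S t" by (simp add: S_def)
    qed
    ultimately show ?thesis by (simp add: compact_eq_bounded_closed)
  qed
  \<comment> \<open>A common point of the chain of superlevel sets is a maximum point.\<close>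
  have "\<Inter>((\<lambda>y. S (h y)) ` S (h z)) \<noteq> {}"
    by (rule compact_chain) (use hz in \<open>auto simp: S_def intro!: compS[unfolded S_def]\<close>)
  then obtain x where x: "\<And>y. y \<in> S (h z) \<Longrightarrow> x \<in> S (h y)" by blast
  have "z \<in> S (h z)" using \<open>z \<in> \<Omega>\<close> by (simp add: S_def)
  then have xz: "x \<in> \<Omega>" "h z \<le> h x" using x[of z] by (auto simp: S_def)
  have "h y \<le> h x" if "y \<in> \<Omega>" for y
    using x[of y] xz that by (cases "h z \<le> h y") (auto simp: S_def)
  then have "w x + \<epsilon>\<^sup>2 * lower_envelope (pF p) (g x) (H x) \<le> 0"
    using sub C2 xz(1) unfolding visc_subsolution_def h_def by blast
  then show False using super[OF xz(1)] xz(2) hz by (simp add: h_def)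
qed

lemma visc_subsolution_minus:
  assumes "visc_supersolution p \<epsilon> \<Omega> v"
  shows "visc_subsolution p \<epsilon> \<Omega> (\<lambda>y. - v y)"
  unfolding visc_subsolution_def
proof (intro conjI allI impI ballI)
  show "usc_on \<Omega> (\<lambda>y. - v y)"
    unfolding usc_on_def
  proof (intro ballI allI impI)
    fix x c assume "x \<in> \<Omega>" "- v x < c"
    then have "\<forall>\<^sub>F y in at x within \<Omega>. - c < v y"
      using assms unfolding visc_supersolution_def lsc_on_def by simp
    then show "\<forall>\<^sub>F y in at x within \<Omega>. - v y < c" by eventually_elim auto
  qed
  fix \<phi> g H x assume C2: "C2_with \<Omega> \<phi> g H" and x: "x \<in> \<Omega>"
    and mx: "\<forall>y\<in>\<Omega>. - v y - \<phi> y \<le> - v x - \<phi> x"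
  have neg: "(- H y) *v h = - (H y *v h)" for y h
    by (simp add: matrix_vector_mult_def vec_eq_iff sum_negf)
  have "C2_with \<Omega> (\<lambda>y. - \<phi> y) (\<lambda>y. - g y) (\<lambda>y. - H y)"
    using C2 unfolding C2_with_def neg
    by (auto intro!: GDERIV_minus has_derivative_minus continuous_intros)
  moreover have "\<forall>y\<in>\<Omega>. v x - (- \<phi> x) \<le> v y - (- \<phi> y)" using mx by auto
  ultimately have "0 \<le> v x + \<epsilon>\<^sup>2 * upper_envelope (pF p) (- g x) (- H x)"
    using assms x unfolding visc_supersolution_def by blast
  then show "- v x + \<epsilon>\<^sup>2 * lower_envelope (pF p) (g x) (H x) \<le> 0"
    unfolding upper_envelope_def lower_envelope_pF_minus by simp
qed


section \<open>Radial and exponential supersolutions\<close>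

lemma inv_exponent_bounds:
  assumes "1 < p"
  shows "0 \<le> inv_exponent p" "inv_exponent p < 1" "conj_exponent p = 1 / (1 - inv_exponent p)"
proof -
  have "0 \<le> inv_exponent p \<and> inv_exponent p < 1 \<and> conj_exponent p = 1 / (1 - inv_exponent p)"
  proof (cases p)
    case (real r)
    then have r: "r > 1" using assms by simp
    have "inv_exponent p = 1 / r"
      using r unfolding inv_exponent_def real one_ereal_def by (simp add: divide_ereal_def inverse_eq_divide)
    moreover have "conj_exponent p = r / (r - 1)" by (simp add: conj_exponent_def real)
    moreover have "r / (r - 1) = 1 / (1 - 1 / r)" using r by (simp add: field_simps)
    ultimately show ?thesis using r by simp
  qed (use assms in \<open>auto simp: inv_exponent_def conj_exponent_def\<close>)
  then show "0 \<le> inv_exponent p" "inv_exponent p < 1" "conj_exponent p = 1 / (1 - inv_exponent p)"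
    by auto
qed

lemma pmatrix_trace_pos:
  assumes "1 < p" "N \<ge> 2"
  shows "0 < pmatrix_trace p N"
  using inv_exponent_bounds(1)[OF assms(1)] assms(2) unfolding pmatrix_trace_def
  by (intro add_pos_nonneg mult_nonneg_nonneg) auto

lemma subsolution_le_radial_supersolution:
  fixes w :: "real^'n \<Rightarrow> real" and f :: "real \<Rightarrow> real"
  assumes "open \<Omega>" "visc_subsolution p \<epsilon> \<Omega> w"
    and "\<And>y. y \<in> frontier \<Omega> \<Longrightarrow> (w \<longlongrightarrow> b) (at y within \<Omega>)"
    and "\<And>y. y \<in> \<Omega> \<Longrightarrow> w y \<le> M"
    and d1: "\<And>y. y \<in> \<Omega> \<Longrightarrow> (f has_real_derivative f1 ((norm (y - a))\<^sup>2)) (at ((norm (y - a))\<^sup>2))"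
    and d2: "\<And>y. y \<in> \<Omega> \<Longrightarrow> (f1 has_real_derivative f2 ((norm (y - a))\<^sup>2)) (at ((norm (y - a))\<^sup>2))"
    and "continuous_on \<Omega> (\<lambda>y. f2 ((norm (y - a))\<^sup>2))"
    and "continuous_on (closure \<Omega>) (\<lambda>y. f ((norm (y - a))\<^sup>2))"
    and "\<And>y. y \<in> frontier \<Omega> \<Longrightarrow> b \<le> f ((norm (y - a))\<^sup>2)"
    and "bounded {y\<in>\<Omega>. f ((norm (y - a))\<^sup>2) < M}"
    and nz: "\<And>y. y \<in> \<Omega> \<Longrightarrow> f1 ((norm (y - a))\<^sup>2) \<noteq> 0"
    and super: "\<And>y s. y \<in> \<Omega> \<Longrightarrow> s = (norm (y - a))\<^sup>2 \<Longrightarrow>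
      \<epsilon>\<^sup>2 * (2 * f1 s * pmatrix_trace p CARD('n) + 4 * f2 s * s * (1 - inv_exponent p)) \<le> f s"
    and "z \<in> \<Omega>"
  shows "w z \<le> f ((norm (z - a))\<^sup>2)"
proof (rule subsolution_le_smooth_supersolution[where w = w and \<phi> = "\<lambda>y. f ((norm (y - a))\<^sup>2)",
      OF assms(1-4) C2_with_radial[of \<Omega> f f1 a f2, folded power2_norm_eq_inner]])
  fix y assume y: "y \<in> \<Omega>"
  let ?s = "(norm (y - a))\<^sup>2"
  have "lower_envelope (pF p) ((2 * f1 ?s) *\<^sub>R (y - a))
      ((2 * f1 ?s) *\<^sub>R mat 1 + (4 * f2 ?s) *\<^sub>R tensor_sq (y - a))
    = - (2 * f1 ?s * pmatrix_trace p CARD('n) + 4 * f2 ?s * ?s * (1 - inv_exponent p))"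
    using nz[OF y] by (subst lower_envelope_radial) (auto simp: power2_norm_eq_inner)
  then show "0 \<le> f ?s + \<epsilon>\<^sup>2 * lower_envelope (pF p) ((2 * f1 ?s) *\<^sub>R (y - a))
      ((2 * f1 ?s) *\<^sub>R mat 1 + (4 * f2 ?s) *\<^sub>R tensor_sq (y - a))"
    using super[OF y refl] by (simp only: mult_minus_right)
qed (use assms in auto)

text \<open>One family covers both profiles: \<open>\<sigma> = 1\<close>, \<open>m > 0\<close>, \<open>k > 0\<close> is the smoothed growing exponential
used for the upper bound, while \<open>\<sigma> = -1\<close>, \<open>m = 0\<close>, \<open>k < 0\<close> is the negative of the decaying exponential,
compared with \<open>- u\<close> for the lower bound. The constant \<open>\<kappa>\<close> creates the room needed at infinity in the second case.\<close>

lemma subsolution_le_exponential_supersolution: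
  fixes w :: "real^'n \<Rightarrow> real"
  defines "Q \<equiv> \<lambda>m a y. sqrt ((norm (y - a :: real^'n))\<^sup>2 + m)"
  assumes "open \<Omega>" "visc_subsolution p \<epsilon> \<Omega> w"
    and "\<And>y. y \<in> frontier \<Omega> \<Longrightarrow> (w \<longlongrightarrow> b) (at y within \<Omega>)"
    and "\<And>y. y \<in> \<Omega> \<Longrightarrow> w y \<le> M"
    and "k \<noteq> 0" "\<sigma> \<noteq> 0"
    and pos: "\<And>y. y \<in> \<Omega> \<Longrightarrow> 0 < Q m a y"
    and "\<And>y. y \<in> frontier \<Omega> \<Longrightarrow> b \<le> \<kappa> + \<sigma> * exp (k * (Q m a y - r))"
    and "bounded {y\<in>\<Omega>. \<kappa> + \<sigma> * exp (k * (Q m a y - r)) < M}"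
    and super: "\<And>y. y \<in> \<Omega> \<Longrightarrow>
      \<epsilon>\<^sup>2 * (\<sigma> * exp (k * (Q m a y - r)) *
        (k * pmatrix_trace p CARD('n) / Q m a y
          + (1 - inv_exponent p) * (norm (y - a))\<^sup>2 * (k\<^sup>2 / (Q m a y)\<^sup>2 - k / (Q m a y)^3)))
        \<le> \<kappa> + \<sigma> * exp (k * (Q m a y - r))"
    and "z \<in> \<Omega>"
  shows "w z \<le> \<kappa> + \<sigma> * exp (k * (Q m a z - r))"
proof -
  \<comment> \<open>\<open>f1\<close> and \<open>f2\<close> are the first two derivatives of \<open>E\<close> in the variable \<open>s = |y - a|\<^sup>2\<close>.\<close>
  define E where "E s = \<sigma> * exp (k * (sqrt (s + m) - r))" for s
  define f1 where "f1 s = E s * (k / (2 * sqrt (s + m)))" for s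
  define f2 where "f2 s = E s * (k\<^sup>2 / (4 * (sqrt (s + m))\<^sup>2) - k / (4 * (sqrt (s + m))^3))" for s
  have Em: "E ((norm (y - a))\<^sup>2) = \<sigma> * exp (k * (Q m a y - r))" for y
    by (simp add: E_def Q_def)
  have dsq: "((\<lambda>s. sqrt (s + m)) has_real_derivative 1 / (2 * sqrt (s + m))) (at s)" if "0 < sqrt (s + m)" for s
    using that by (auto intro!: derivative_eq_intros simp: field_simps)
  have dE: "(E has_real_derivative f1 s) (at s)" if "0 < sqrt (s + m)" for s
    unfolding E_def[abs_def] f1_def
    by (rule derivative_eq_intros dsq[OF that] refl)+ (simp add: E_def)
  have df1: "(f1 has_real_derivative f2 s) (at s)" if "0 < sqrt (s + m)" for s
    unfolding f1_def[abs_def]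
  proof -
    define q where "q = sqrt (s + m)"
    have q: "q > 0" using that by (simp add: q_def)
    have "((\<lambda>s. k / (2 * sqrt (s + m))) has_real_derivative - k * (2 * (1 / (2 * q))) / ((2 * q) * (2 * q))) (at s)"
      using DERIV_divide[OF DERIV_const DERIV_cmult[OF dsq[OF that], of 2], of k] q unfolding q_def
      by simp
    from DERIV_mult[OF dE[OF that] this]
    show "((\<lambda>s. E s * (k / (2 * sqrt (s + m)))) has_real_derivative f2 s) (at s)"
    proof (rule DERIV_cong)
      show "f1 s * (k / (2 * sqrt (s + m))) + - k * (2 * (1 / (2 * q))) / (2 * q * (2 * q)) * E s = f2 s"
        unfolding f1_def f2_def q_def[symmetric] using q
        by (simp add: field_simps power2_eq_square power3_eq_cube)
    qed
  qed
  have Qpos: "0 < sqrt ((norm (y - a))\<^sup>2 + m)" if "y \<in> \<Omega>" for y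
    using pos[OF that] by (simp add: Q_def)
  have "w z \<le> \<kappa> + E ((norm (z - a))\<^sup>2)"
  proof (rule subsolution_le_radial_supersolution[where f = "\<lambda>s. \<kappa> + E s" and ?f1.0 = f1 and ?f2.0 = f2, OF assms(2-5)])
    fix y assume y: "y \<in> \<Omega>"
    show "((\<lambda>s. \<kappa> + E s) has_real_derivative f1 ((norm (y - a))\<^sup>2)) (at ((norm (y - a))\<^sup>2))"
      using dE[OF Qpos[OF y]] by (auto intro!: derivative_eq_intros)
    show "(f1 has_real_derivative f2 ((norm (y - a))\<^sup>2)) (at ((norm (y - a))\<^sup>2))"
      using df1[OF Qpos[OF y]] .
    show "f1 ((norm (y - a))\<^sup>2) \<noteq> 0"
      using Qpos[OF y] assms(6,7) by (simp add: f1_def E_def)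
    fix s assume s: "s = (norm (y - a))\<^sup>2"
    have "2 * f1 s * pmatrix_trace p CARD('n) + 4 * f2 s * s * (1 - inv_exponent p)
      = E s * (k * pmatrix_trace p CARD('n) / Q m a y
          + (1 - inv_exponent p) * s * (k\<^sup>2 / (Q m a y)\<^sup>2 - k / (Q m a y)^3))"
    proof -
      define q where "q = Q m a y"
      have q: "q > 0" "sqrt (s + m) = q" using pos[OF y] by (simp_all add: q_def Q_def s)
      have regroup: "2 * (e * A) * T + 4 * (e * B) * s * c = e * (2 * A * T + c * s * (4 * B))"
        for e A B T c :: real by (simp add: algebra_simps)
      have "2 * (k / (2 * q)) * T = k * T / q" for T by simp
      moreover have "4 * (k\<^sup>2 / (4 * q\<^sup>2) - k / (4 * q ^ 3)) = k\<^sup>2 / q\<^sup>2 - k / q ^ 3"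
        by (simp add: right_diff_distrib)
      ultimately show ?thesis
        unfolding f1_def f2_def q(2) q_def[symmetric] regroup by simp
    qed
    then show "\<epsilon>\<^sup>2 * (2 * f1 s * pmatrix_trace p CARD('n) + 4 * f2 s * s * (1 - inv_exponent p)) \<le> \<kappa> + E s"
      using super[OF y] by (simp add: s Em)
  next
    show "continuous_on \<Omega> (\<lambda>y. f2 ((norm (y - a))\<^sup>2))"
      unfolding f2_def E_def using Qpos by (intro continuous_intros) force+
    show "continuous_on (closure \<Omega>) (\<lambda>y. \<kappa> + E ((norm (y - a))\<^sup>2))"
      unfolding E_def by (intro continuous_intros)
  qed (use assms in \<open>auto simp: Em\<close>)
  then show ?thesis by (simp add: Em)
qed

section \<open>Exponential bounds for the solution\<close>

lemma bounded_visc_solutionD: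
  assumes "bounded_visc_solution p \<epsilon> \<Omega> u"
  shows "visc_subsolution p \<epsilon> \<Omega> u" "visc_subsolution p \<epsilon> \<Omega> (\<lambda>y. - u y)"
    "\<And>y. y \<in> frontier \<Omega> \<Longrightarrow> (u \<longlongrightarrow> 1) (at y within \<Omega>)"
    "\<And>y. y \<in> frontier \<Omega> \<Longrightarrow> ((\<lambda>y. - u y) \<longlongrightarrow> -1) (at y within \<Omega>)"
    "\<exists>M\<ge>1. \<forall>y\<in>\<Omega>. \<bar>u y\<bar> \<le> M"
proof -
  obtain B where "\<forall>y\<in>\<Omega>. \<bar>u y\<bar> \<le> B"
    using assms unfolding bounded_visc_solution_def bounded_iff by auto
  then show "\<exists>M\<ge>1. \<forall>y\<in>\<Omega>. \<bar>u y\<bar> \<le> M" by (intro exI[of _ "max B 1"]) auto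
qed (use assms in \<open>auto simp: bounded_visc_solution_def visc_solution_def intro: visc_subsolution_minus tendsto_minus\<close>)

lemma bounded_norm_diff_le: "(\<And>y. y \<in> S \<Longrightarrow> norm (y - a) \<le> B) \<Longrightarrow> bounded S"
  for S :: "'a::real_normed_vector set"
  by (rule bounded_subset[OF bounded_cball[of a B]]) (auto simp: dist_norm norm_minus_commute)

text \<open>The barrier equals 1 on the sphere around \<open>x\<close> that touches the boundary, hence is at least 1 on the
whole boundary. It tends to infinity with \<open>|y|\<close>, so it dominates \<open>u\<close> far away, whatever the bound on \<open>|u|\<close>.
Smoothing by \<open>\<delta>\<close> keeps the first-order term of size \<open>k \<tau> / \<delta>\<close> near the center.\<close>

lemma solution_le_exponential:
  fixes u :: "real^'n \<Rightarrow> real"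
  assumes "CARD('n) \<ge> 2" "1 < p" "open \<Omega>" and sol: "bounded_visc_solution p \<epsilon> \<Omega> u"
    and "x \<in> \<Omega>" "0 < \<delta>" "0 < k"
    and small: "\<epsilon>\<^sup>2 * (k * pmatrix_trace p CARD('n) / \<delta> + (1 - inv_exponent p) * k\<^sup>2) \<le> 1"
  shows "u x \<le> exp (k * (\<delta> - sqrt ((infdist x (frontier \<Omega>))\<^sup>2 + \<delta>\<^sup>2)))"
proof -
  define r where "r = sqrt ((infdist x (frontier \<Omega>))\<^sup>2 + \<delta>\<^sup>2)"
  define T where "T = pmatrix_trace p CARD('n)"
  define \<theta> where "\<theta> = 1 - inv_exponent p"
  have T: "T > 0" unfolding T_def using pmatrix_trace_pos assms(1,2) by blast
  have \<theta>: "\<theta> > 0" unfolding \<theta>_def using inv_exponent_bounds(2)[OF assms(2)] by simp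
  obtain M where M: "M \<ge> 1" "\<And>y. y \<in> \<Omega> \<Longrightarrow> \<bar>u y\<bar> \<le> M"
    using bounded_visc_solutionD(5)[OF sol] by blast
  have "u x \<le> 0 + 1 * exp (k * (sqrt ((norm (x - x))\<^sup>2 + \<delta>\<^sup>2) - r))"
  proof (rule subsolution_le_exponential_supersolution[OF assms(3) bounded_visc_solutionD(1,3)[OF sol]])
    show "u y \<le> M" if "y \<in> \<Omega>" for y using M(2)[OF that] by simp
    show "bounded {y \<in> \<Omega>. 0 + 1 * exp (k * (sqrt ((norm (y - x))\<^sup>2 + \<delta>\<^sup>2) - r)) < M}"
    proof (rule bounded_norm_diff_le)
      fix y assume "y \<in> {y \<in> \<Omega>. 0 + 1 * exp (k * (sqrt ((norm (y - x))\<^sup>2 + \<delta>\<^sup>2) - r)) < M}"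
      then have "exp (k * (sqrt ((norm (y - x))\<^sup>2 + \<delta>\<^sup>2) - r)) < exp (ln M)" using M(1) by simp
      then have "sqrt ((norm (y - x))\<^sup>2 + \<delta>\<^sup>2) < ln M / k + r"
        using \<open>0 < k\<close> by (simp add: field_simps)
      moreover have "norm (y - x) \<le> sqrt ((norm (y - x))\<^sup>2 + \<delta>\<^sup>2)" by (rule real_le_rsqrt) simp
      ultimately show "norm (y - x) \<le> ln M / k + r" by linarith
    qed
    show "1 \<le> 0 + 1 * exp (k * (sqrt ((norm (y - x))\<^sup>2 + \<delta>\<^sup>2) - r))" if "y \<in> frontier \<Omega>" for y
    proof -
      have "infdist x (frontier \<Omega>) \<le> norm (y - x)"
        using infdist_le[OF that, of x] by (simp add: dist_norm norm_minus_commute)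
      then have "r \<le> sqrt ((norm (y - x))\<^sup>2 + \<delta>\<^sup>2)"
        unfolding r_def by (intro real_sqrt_le_mono add_right_mono power_mono) (auto simp: infdist_nonneg)
      then show ?thesis using \<open>0 < k\<close> by simp
    qed
    fix y assume "y \<in> \<Omega>"
    define q where "q = sqrt ((norm (y - x))\<^sup>2 + \<delta>\<^sup>2)"
    have q: "\<delta> \<le> q" "q > 0" "(norm (y - x))\<^sup>2 \<le> q\<^sup>2"
      using \<open>0 < \<delta>\<close> by (auto simp: q_def intro!: real_le_rsqrt add_nonneg_pos)
    show "0 < sqrt ((norm (y - x))\<^sup>2 + \<delta>\<^sup>2)" using q by (simp add: q_def)
    \<comment> \<open>The smoothing lowers the second-order term, so it is bounded by its unsmoothed value \<open>\<theta> k\<^sup>2\<close>.\<close>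
    have "(norm (y - x))\<^sup>2 * (k\<^sup>2 / q\<^sup>2 - k / q^3) \<le> (norm (y - x))\<^sup>2 * (k\<^sup>2 / q\<^sup>2)"
      using q \<open>0 < k\<close> by (intro mult_left_mono) auto
    also have "\<dots> \<le> q\<^sup>2 * (k\<^sup>2 / q\<^sup>2)" using q by (intro mult_right_mono) auto
    also have "\<dots> = k\<^sup>2" using q by simp
    finally have "\<theta> * ((norm (y - x))\<^sup>2 * (k\<^sup>2 / q\<^sup>2 - k / q^3)) \<le> \<theta> * k\<^sup>2"
      using \<theta> by (intro mult_left_mono) auto
    moreover have "k * T / q \<le> k * T / \<delta>"
      using q T \<open>0 < k\<close> \<open>0 < \<delta>\<close> by (intro divide_left_mono) auto
    ultimately have "\<epsilon>\<^sup>2 * (k * T / q + \<theta> * (norm (y - x))\<^sup>2 * (k\<^sup>2 / q\<^sup>2 - k / q^3))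
        \<le> \<epsilon>\<^sup>2 * (k * T / \<delta> + \<theta> * k\<^sup>2)"
      by (intro mult_left_mono) (auto simp: mult.assoc)
    also have "\<dots> \<le> 1" using small by (simp add: T_def \<theta>_def)
    finally have "exp (k * (q - r)) * (\<epsilon>\<^sup>2 * (k * T / q + \<theta> * (norm (y - x))\<^sup>2 * (k\<^sup>2 / q\<^sup>2 - k / q^3)))
        \<le> exp (k * (q - r)) * 1"
      by (intro mult_left_mono) auto
    then show "\<epsilon>\<^sup>2 * (1 * exp (k * (sqrt ((norm (y - x))\<^sup>2 + \<delta>\<^sup>2) - r)) *
        (k * pmatrix_trace p CARD('n) / sqrt ((norm (y - x))\<^sup>2 + \<delta>\<^sup>2)
          + (1 - inv_exponent p) * (norm (y - x))\<^sup>2 *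
            (k\<^sup>2 / (sqrt ((norm (y - x))\<^sup>2 + \<delta>\<^sup>2))\<^sup>2 - k / (sqrt ((norm (y - x))\<^sup>2 + \<delta>\<^sup>2))^3)))
        \<le> 0 + 1 * exp (k * (sqrt ((norm (y - x))\<^sup>2 + \<delta>\<^sup>2) - r))"
      unfolding q_def[symmetric] T_def[symmetric] \<theta>_def[symmetric] by (simp only: mult_1 mult_1_right add_0 mult_ac)
  qed (use assms in auto)
  then show ?thesis using \<open>0 < \<delta>\<close> by (simp add: r_def)
qed

text \<open>Comparison of \<open>- u\<close> with \<open>\<kappa> (|y - x|\<^sup>2 + C)\<close>, which is a supersolution for large \<open>C\<close> and coercive; then
\<open>\<kappa> \<rightarrow> 0\<close>.\<close>

lemma solution_nonneg:
  fixes u :: "real^'n \<Rightarrow> real"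
  assumes "CARD('n) \<ge> 2" "1 < p" "open \<Omega>" and sol: "bounded_visc_solution p \<epsilon> \<Omega> u"
    and "x \<in> \<Omega>"
  shows "0 \<le> u x"
proof -
  define T where "T = pmatrix_trace p CARD('n)"
  have T: "T > 0" unfolding T_def using pmatrix_trace_pos assms(1,2) by blast
  obtain M where M: "M \<ge> 1" "\<And>y. y \<in> \<Omega> \<Longrightarrow> \<bar>u y\<bar> \<le> M"
    using bounded_visc_solutionD(5)[OF sol] by blast
  define C where "C = 2 * \<epsilon>\<^sup>2 * T"
  have C: "C \<ge> 0" using T by (simp add: C_def)
  have le: "- u x \<le> \<kappa> * C" if \<kappa>: "\<kappa> > 0" for \<kappa>
  proof -
    have "- u x \<le> \<kappa> * ((norm (x - x))\<^sup>2 + C)"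
    proof (rule subsolution_le_radial_supersolution[where f = "\<lambda>s. \<kappa> * (s + C)" and ?f1.0 = "\<lambda>_. \<kappa>" and ?f2.0 = "\<lambda>_. 0",
          OF assms(3) bounded_visc_solutionD(2,4)[OF sol]])
      show "bounded {y \<in> \<Omega>. \<kappa> * ((norm (y - x))\<^sup>2 + C) < M}"
      proof (rule bounded_norm_diff_le)
        fix y assume "y \<in> {y \<in> \<Omega>. \<kappa> * ((norm (y - x))\<^sup>2 + C) < M}"
        then have "(norm (y - x))\<^sup>2 \<le> M / \<kappa>"
        proof -
          have "\<kappa> * (norm (y - x))\<^sup>2 + \<kappa> * C < M"
            using \<open>y \<in> _\<close> by (simp add: distrib_left)
          moreover have "0 \<le> \<kappa> * C" using \<kappa> C by simp
          ultimately show ?thesis using \<kappa> by (simp add: pos_le_divide_eq mult.commute)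
        qed
        then show "norm (y - x) \<le> sqrt (M / \<kappa>)" by (rule real_le_rsqrt)
      qed
      show "- u y \<le> M" if "y \<in> \<Omega>" for y using M(2)[OF that] by linarith
      show "-1 \<le> \<kappa> * ((norm (y - x))\<^sup>2 + C)" for y
      proof -
        have "0 \<le> \<kappa> * ((norm (y - x))\<^sup>2 + C)" using \<kappa> C by simp
        then show ?thesis by linarith
      qed
      show "((\<lambda>s. \<kappa> * (s + C)) has_real_derivative \<kappa>) (at ((norm (y - x))\<^sup>2))" for y
        by (auto intro!: derivative_eq_intros)
      show "((\<lambda>_. \<kappa>) has_real_derivative 0) (at ((norm (y - x))\<^sup>2))" for y by simp
      fix y and s :: real assume "s = (norm (y - x))\<^sup>2"
      then have "s \<ge> 0" by simp
      then show "\<epsilon>\<^sup>2 * (2 * \<kappa> * pmatrix_trace p CARD('n) + 4 * 0 * s * (1 - inv_exponent p)) \<le> \<kappa> * (s + C)"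
        using \<kappa> by (simp add: C_def T_def algebra_simps)
    qed (use \<kappa> assms in \<open>auto intro!: continuous_intros\<close>)
    then show ?thesis by simp
  qed
  have "0 \<le> u x + e" if "0 < e" for e
  proof -
    have "e / (C + 1) * C \<le> e" using that C by (simp add: field_simps)
    moreover have "- u x \<le> e / (C + 1) * C" by (rule le) (use that C in simp)
    ultimately show ?thesis by linarith
  qed
  then show ?thesis by (rule field_le_epsilon)
qed

text \<open>The decaying profile vanishes at infinity instead of blowing up there. Since \<open>u \<ge> 0\<close>, subtracting any \<open>\<kappa> > 0\<close> from
it is enough to confine the comparison to a bounded set. The exterior ball bounds the first-order term by
\<open>k \<tau> / \<rho>\<close> and keeps the center, where the profile is not smooth, away from the domain.\<close>

lemma exponential_le_solution:
  fixes u :: "real^'n \<Rightarrow> real"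
  assumes "CARD('n) \<ge> 2" "1 < p" "open \<Omega>" and sol: "bounded_visc_solution p \<epsilon> \<Omega> u"
    and "x \<in> \<Omega>" "0 < \<rho>" "0 < k" and ext: "ball a \<rho> \<inter> closure \<Omega> = {}"
    and large: "1 \<le> \<epsilon>\<^sup>2 * ((1 - inv_exponent p) * k\<^sup>2 - k * pmatrix_trace p CARD('n) / \<rho>)"
  shows "exp (- k * (norm (x - a) - \<rho>)) \<le> u x"
proof -
  define T where "T = pmatrix_trace p CARD('n)"
  define \<theta> where "\<theta> = 1 - inv_exponent p"
  have T: "T > 0" unfolding T_def using pmatrix_trace_pos assms(1,2) by blast
  have \<theta>: "\<theta> > 0" unfolding \<theta>_def using inv_exponent_bounds(2)[OF assms(2)] by simp
  have far: "\<rho> \<le> norm (y - a)" if "y \<in> closure \<Omega>" for y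
    using ext that by (auto simp: dist_norm norm_minus_commute disjoint_iff not_less)
  have "- u x \<le> \<kappa> + (-1) * exp (- k * (sqrt ((norm (x - a))\<^sup>2 + 0) - \<rho>))" if \<kappa>: "\<kappa> > 0" for \<kappa>
  proof (rule subsolution_le_exponential_supersolution[OF assms(3) bounded_visc_solutionD(2,4)[OF sol]])
    show "- u y \<le> 0" if "y \<in> \<Omega>" for y using solution_nonneg[OF assms(1-3) sol that] by simp
    show "bounded {y \<in> \<Omega>. \<kappa> + (-1) * exp (- k * (sqrt ((norm (y - a))\<^sup>2 + 0) - \<rho>)) < 0}"
    proof (rule bounded_norm_diff_le)
      fix y assume "y \<in> {y \<in> \<Omega>. \<kappa> + (-1) * exp (- k * (sqrt ((norm (y - a))\<^sup>2 + 0) - \<rho>)) < 0}"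
      then have "exp (ln \<kappa>) < exp (- k * (norm (y - a) - \<rho>))" using \<kappa> by simp
      then show "norm (y - a) \<le> \<rho> - ln \<kappa> / k"
        using \<open>0 < k\<close> by (simp add: field_simps)
    qed
    show "- 1 \<le> \<kappa> + (-1) * exp (- k * (sqrt ((norm (y - a))\<^sup>2 + 0) - \<rho>))" if "y \<in> frontier \<Omega>" for y
    proof -
      have "exp (- k * (norm (y - a) - \<rho>)) \<le> 1"
        using far[of y] that \<open>0 < k\<close> by (simp add: frontier_def)
      then have "- 1 \<le> \<kappa> + (-1) * exp (- k * (norm (y - a) - \<rho>))" using \<kappa> by linarith
      then show ?thesis by simp
    qed
    fix y assume y: "y \<in> \<Omega>"
    define q where "q = sqrt ((norm (y - a))\<^sup>2 + 0)"
    have q: "q = norm (y - a)" by (simp add: q_def)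
    have "\<rho> \<le> q" using far[of y] y closure_subset q by auto
    then have "q > 0" using \<open>0 < \<rho>\<close> by simp
    then show "0 < sqrt ((norm (y - a))\<^sup>2 + 0)" by (simp add: q_def)
    define E where "E = exp (- k * (q - \<rho>))"
    have E: "E > 0" by (simp add: E_def)
    have "k * T / q \<le> k * T / \<rho>"
      using \<open>\<rho> \<le> q\<close> \<open>0 < q\<close> T \<open>0 < k\<close> \<open>0 < \<rho>\<close> by (intro divide_left_mono) auto
    moreover have "0 \<le> \<theta> * (k / q)" using \<theta> \<open>0 < q\<close> \<open>0 < k\<close> by simp
    moreover have "- k * T / q + \<theta> * q\<^sup>2 * ((- k)\<^sup>2 / q\<^sup>2 - (- k) / q^3) = \<theta> * k\<^sup>2 - k * T / q + \<theta> * (k / q)"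
      using \<open>0 < q\<close> by (simp add: field_simps power2_eq_square power3_eq_cube)
    ultimately have "\<theta> * k\<^sup>2 - k * T / \<rho> \<le> - k * T / q + \<theta> * q\<^sup>2 * ((- k)\<^sup>2 / q\<^sup>2 - (- k) / q^3)" (is "_ \<le> ?D")
      by linarith
    then have "\<epsilon>\<^sup>2 * (\<theta> * k\<^sup>2 - k * T / \<rho>) \<le> \<epsilon>\<^sup>2 * ?D" by (intro mult_left_mono) auto
    then have "1 \<le> \<epsilon>\<^sup>2 * ?D" using large by (simp add: T_def \<theta>_def)
    then have "E * 1 \<le> E * (\<epsilon>\<^sup>2 * ?D)" using E by (intro mult_left_mono) auto
    moreover have "\<epsilon>\<^sup>2 * ((-1) * E * ?D) = - (E * (\<epsilon>\<^sup>2 * ?D))" by simp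
    ultimately have "\<epsilon>\<^sup>2 * ((-1) * E * ?D) \<le> \<kappa> + (-1) * E" using \<kappa> by linarith
    then show "\<epsilon>\<^sup>2 * ((-1) * exp (- k * (sqrt ((norm (y - a))\<^sup>2 + 0) - \<rho>)) *
        (- k * pmatrix_trace p CARD('n) / sqrt ((norm (y - a))\<^sup>2 + 0)
          + (1 - inv_exponent p) * (norm (y - a))\<^sup>2 *
            ((- k)\<^sup>2 / (sqrt ((norm (y - a))\<^sup>2 + 0))\<^sup>2 - (- k) / (sqrt ((norm (y - a))\<^sup>2 + 0))^3)))
        \<le> \<kappa> + (-1) * exp (- k * (sqrt ((norm (y - a))\<^sup>2 + 0) - \<rho>))"
      unfolding q_def[symmetric] T_def[symmetric] \<theta>_def[symmetric] E_def[symmetric]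
      unfolding q[symmetric] .
  qed (use assms in auto)
  then have "exp (- k * (norm (x - a) - \<rho>)) \<le> u x + \<kappa>" if "\<kappa> > 0" for \<kappa>
    using that by fastforce
  then show ?thesis by (rule field_le_epsilon)
qed


text \<open>This is where the hypothesis on the boundary enters: it rules out boundary points, such as those of a
slit, that are surrounded by the closure of the domain.\<close>

lemma exists_exterior_ball_near_frontier:
  fixes \<Omega> :: "'a::euclidean_space set"
  assumes "frontier \<Omega> = frontier (- closure \<Omega>)" "z \<in> frontier \<Omega>" "0 < t"
  obtains a \<rho> where "0 < \<rho>" "ball a \<rho> \<inter> closure \<Omega> = {}" "dist z a < t"
proof -
  have "z \<in> closure (- closure \<Omega>)" using assms(1,2) by (simp add: frontier_def)
  then obtain a where a: "a \<in> - closure \<Omega>" "dist a z < t"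
    using assms(3) unfolding closure_approachable by blast
  moreover obtain \<rho> where "0 < \<rho>" "ball a \<rho> \<subseteq> - closure \<Omega>"
    using a(1) openE[of "- closure \<Omega>" a] by (auto simp: open_Compl)
  ultimately show thesis by (intro that[of \<rho> a]) (auto simp: dist_commute)
qed

text \<open>For fixed \<open>\<epsilon>\<close> the exponential lower bound holds as soon as \<open>k\<close> is large enough, and any such \<open>k\<close> gives positivity.\<close>

lemma solution_pos:
  fixes u :: "real^'n \<Rightarrow> real"
  assumes "CARD('n) \<ge> 2" "1 < p" "open \<Omega>" "bounded_visc_solution p \<epsilon> \<Omega> u"
    and "frontier \<Omega> \<noteq> {}" "frontier \<Omega> = frontier (- closure \<Omega>)" "x \<in> \<Omega>" "0 < \<epsilon>"
  shows "0 < u x"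
proof -
  define T where "T = pmatrix_trace p CARD('n)"
  define \<theta> where "\<theta> = 1 - inv_exponent p"
  have T: "T > 0" unfolding T_def using pmatrix_trace_pos assms(1,2) by blast
  have \<theta>: "\<theta> > 0" unfolding \<theta>_def using inv_exponent_bounds(2)[OF assms(2)] by simp
  obtain z where "z \<in> frontier \<Omega>" using assms(5) by blast
  then obtain a \<rho> where a: "0 < \<rho>" "ball a \<rho> \<inter> closure \<Omega> = {}"
    using exists_exterior_ball_near_frontier[OF assms(6)] zero_less_one by metis
  \<comment> \<open>The first summand makes \<open>\<theta> k - T / \<rho> \<ge> 1\<close>, the second one \<open>\<epsilon>\<^sup>2 k \<ge> 1\<close>.\<close>
  define k where "k = (1 + T / \<rho>) / \<theta> + 1 / \<epsilon>\<^sup>2"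
  have k: "k > 0" unfolding k_def using T \<theta> a(1) assms(8) by (intro add_pos_pos divide_pos_pos) auto
  have "\<theta> * ((1 + T / \<rho>) / \<theta>) = 1 + T / \<rho>" using \<theta> by simp
  then have "\<theta> * k = 1 + T / \<rho> + \<theta> / \<epsilon>\<^sup>2" by (simp add: k_def distrib_left)
  moreover have "0 < \<theta> / \<epsilon>\<^sup>2" using \<theta> assms(8) by simp
  ultimately have "1 \<le> \<theta> * k - T / \<rho>" by linarith
  moreover have "1 \<le> \<epsilon>\<^sup>2 * k" using T \<theta> a(1) assms(8) by (simp add: k_def distrib_left)
  ultimately have "1 * 1 \<le> (\<epsilon>\<^sup>2 * k) * (\<theta> * k - T / \<rho>)" by (intro mult_mono) auto
  then have "1 \<le> \<epsilon>\<^sup>2 * (\<theta> * k\<^sup>2 - k * T / \<rho>)" by (simp add: algebra_simps power2_eq_square)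
  then have "exp (- k * (norm (x - a) - \<rho>)) \<le> u x"
    by (intro exponential_le_solution[OF assms(1-4,7) a(1) k a(2)]) (simp add: T_def \<theta>_def)
  then show ?thesis by (rule less_le_trans[OF exp_gt_zero])
qed

section \<open>The logarithmic limit\<close>

lemma eventually_small_right:
  fixes c e :: real assumes "0 < e"
  shows "eventually (\<lambda>\<epsilon>. \<epsilon> * c \<le> e \<and> 0 < \<epsilon>) (at_right 0)"
proof -
  have "((\<lambda>\<epsilon>. \<epsilon> * c) \<longlongrightarrow> 0 * c) (at_right 0)" by (intro tendsto_intros)
  then have "eventually (\<lambda>\<epsilon>. \<epsilon> * c < e) (at_right 0)" using assms by (intro order_tendstoD) auto
  then show ?thesis using eventually_at_right_less[of 0] by eventually_elim auto
qed

text \<open>The rate \<open>k = (1 - t) \<surd>p' / \<epsilon>\<close> leaves the gap \<open>1 - (1 - t)\<^sup>2\<close> in the supersolution inequality, which absorbs the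
first-order term of size \<open>O(\<epsilon>)\<close>. The same \<open>t\<close> serves as smoothing parameter \<open>\<delta>\<close>.\<close>

lemma eventually_eps_ln_less:
  fixes u :: "real \<Rightarrow> real^'n \<Rightarrow> real"
  assumes "CARD('n) \<ge> 2" "1 < p" "open \<Omega>"
    and sol: "\<And>\<epsilon>. \<epsilon> > 0 \<Longrightarrow> bounded_visc_solution p \<epsilon> \<Omega> (u \<epsilon>)"
    and pos: "\<And>\<epsilon>. \<epsilon> > 0 \<Longrightarrow> 0 < u \<epsilon> x" and "x \<in> \<Omega>"
    and c: "- sqrt (conj_exponent p) * infdist x (frontier \<Omega>) < c"
  shows "eventually (\<lambda>\<epsilon>. \<epsilon> * ln (u \<epsilon> x) < c) (at_right 0)"
proof -
  define T where "T = pmatrix_trace p CARD('n)"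
  define \<theta> where "\<theta> = 1 - inv_exponent p"
  have \<theta>: "\<theta> > 0" unfolding \<theta>_def using inv_exponent_bounds(2)[OF assms(2)] by simp
  define L where "L = sqrt (conj_exponent p)"
  have "L = sqrt (1 / \<theta>)" unfolding L_def \<theta>_def inv_exponent_bounds(3)[OF assms(2)] ..
  then have L: "L > 0" "\<theta> * L\<^sup>2 = 1" using \<theta> by auto
  define d where "d = infdist x (frontier \<Omega>)"
  have d: "d \<ge> 0" by (simp add: d_def infdist_nonneg)
  have "((\<lambda>t. (1 - t) * L * (t - sqrt (d\<^sup>2 + t\<^sup>2))) \<longlongrightarrow> (1 - 0) * L * (0 - sqrt (d\<^sup>2 + 0\<^sup>2))) (at_right 0)"
    by (intro tendsto_intros)
  then have "eventually (\<lambda>t. (1 - t) * L * (t - sqrt (d\<^sup>2 + t\<^sup>2)) < c) (at_right 0)"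
    using c d by (intro order_tendstoD) (auto simp: d_def L_def)
  moreover have "eventually (\<lambda>t. t * 1 \<le> 1/2 \<and> 0 < t) (at_right (0::real))"
    by (rule eventually_small_right) simp
  ultimately obtain t where t: "(1 - t) * L * (t - sqrt (d\<^sup>2 + t\<^sup>2)) < c" "t \<le> 1/2" "0 < t"
    using eventually_happens[OF eventually_conj] by force
  define l where "l = (1 - t) * L"
  have l: "l > 0" using t L by (simp add: l_def)
  have "(1 - t)\<^sup>2 < 1\<^sup>2" using t by (intro power_strict_mono) auto
  then have gap: "0 < 1 - (1 - t)\<^sup>2" by simp
  have "eventually (\<lambda>\<epsilon>. \<epsilon> * (l * T / t) \<le> 1 - (1 - t)\<^sup>2 \<and> 0 < \<epsilon>) (at_right 0)"
    by (rule eventually_small_right[OF gap])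
  then show ?thesis
  proof eventually_elim
    case (elim \<epsilon>)
    then have \<epsilon>: "\<epsilon> > 0" by simp
    have "\<epsilon>\<^sup>2 * (l / \<epsilon> * T / t + \<theta> * (l / \<epsilon>)\<^sup>2) = \<epsilon> * (l * T / t) + \<theta> * l\<^sup>2"
      using \<epsilon> t(3) by (simp add: field_simps power2_eq_square)
    also have "\<theta> * l\<^sup>2 = (1 - t)\<^sup>2" using L(2) by (simp add: l_def power_mult_distrib mult_ac)
    finally have "\<epsilon>\<^sup>2 * (l / \<epsilon> * T / t + \<theta> * (l / \<epsilon>)\<^sup>2) \<le> 1" using elim by linarith
    then have "u \<epsilon> x \<le> exp (l / \<epsilon> * (t - sqrt (d\<^sup>2 + t\<^sup>2)))"
      unfolding d_def using \<epsilon> l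
      by (intro solution_le_exponential[OF assms(1-3) sol[OF \<epsilon>] assms(6) t(3)]) (auto simp: T_def \<theta>_def)
    then have "ln (u \<epsilon> x) \<le> ln (exp (l / \<epsilon> * (t - sqrt (d\<^sup>2 + t\<^sup>2))))"
      using pos[OF \<epsilon>] by (simp only: ln_le_cancel_iff exp_gt_zero)
    then have "ln (u \<epsilon> x) \<le> l / \<epsilon> * (t - sqrt (d\<^sup>2 + t\<^sup>2))" by (simp only: ln_exp)
    then have "\<epsilon> * ln (u \<epsilon> x) \<le> \<epsilon> * (l / \<epsilon> * (t - sqrt (d\<^sup>2 + t\<^sup>2)))"
      using \<epsilon> by (intro mult_left_mono) auto
    also have "\<dots> = l * (t - sqrt (d\<^sup>2 + t\<^sup>2))" using \<epsilon> by simp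
    finally show ?case using t(1) by (simp add: l_def)
  qed
qed

text \<open>Here the rate is \<open>k = (1 + t) \<surd>p' / \<epsilon>\<close>, and \<open>t\<close> also bounds the distance from the center of the exterior ball
to a nearest boundary point. The radius \<open>\<rho>\<close> depends on \<open>t\<close> but not on \<open>\<epsilon>\<close>, so the first-order term is again
\<open>O(\<epsilon>)\<close>.\<close>

lemma eventually_less_eps_ln:
  fixes u :: "real \<Rightarrow> real^'n \<Rightarrow> real"
  assumes "CARD('n) \<ge> 2" "1 < p" "open \<Omega>"
    and sol: "\<And>\<epsilon>. \<epsilon> > 0 \<Longrightarrow> bounded_visc_solution p \<epsilon> \<Omega> (u \<epsilon>)"
    and pos: "\<And>\<epsilon>. \<epsilon> > 0 \<Longrightarrow> 0 < u \<epsilon> x" and "x \<in> \<Omega>"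
    and "frontier \<Omega> \<noteq> {}" "frontier \<Omega> = frontier (- closure \<Omega>)"
    and c: "c < - sqrt (conj_exponent p) * infdist x (frontier \<Omega>)"
  shows "eventually (\<lambda>\<epsilon>. c < \<epsilon> * ln (u \<epsilon> x)) (at_right 0)"
proof -
  define T where "T = pmatrix_trace p CARD('n)"
  define \<theta> where "\<theta> = 1 - inv_exponent p"
  have \<theta>: "\<theta> > 0" unfolding \<theta>_def using inv_exponent_bounds(2)[OF assms(2)] by simp
  define L where "L = sqrt (conj_exponent p)"
  have "L = sqrt (1 / \<theta>)" unfolding L_def \<theta>_def inv_exponent_bounds(3)[OF assms(2)] ..
  then have L: "L > 0" "\<theta> * L\<^sup>2 = 1" using \<theta> by auto
  define d where "d = infdist x (frontier \<Omega>)"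
  have "((\<lambda>t. - ((1 + t) * L * (d + t))) \<longlongrightarrow> - ((1 + 0) * L * (d + 0))) (at_right 0)"
    by (intro tendsto_intros)
  then have "eventually (\<lambda>t. c < - ((1 + t) * L * (d + t))) (at_right 0)"
    using c by (intro order_tendstoD) (auto simp: d_def L_def)
  moreover have "eventually (\<lambda>t. 0 < t) (at_right (0::real))" by (rule eventually_at_right_less)
  ultimately obtain t where t: "c < - ((1 + t) * L * (d + t))" "0 < t"
    using eventually_happens[OF eventually_conj] by force
  obtain z where z: "z \<in> frontier \<Omega>" "d = dist x z"
    using infdist_attains_inf[OF frontier_closed assms(7)] unfolding d_def by blast
  obtain a \<rho> where a: "0 < \<rho>" "ball a \<rho> \<inter> closure \<Omega> = {}" "dist z a < t"
    using exists_exterior_ball_near_frontier[OF assms(8) z(1) t(2)] .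
  have xa: "norm (x - a) - \<rho> \<le> d + t"
    using dist_triangle[of x a z] z(2) a(1,3) by (simp add: dist_norm)
  define l where "l = (1 + t) * L"
  have l: "l > 0" using t L by (simp add: l_def)
  have "1\<^sup>2 < (1 + t)\<^sup>2" using t by (intro power_strict_mono) auto
  then have gap: "0 < (1 + t)\<^sup>2 - 1" by simp
  have "eventually (\<lambda>\<epsilon>. \<epsilon> * (l * T / \<rho>) \<le> (1 + t)\<^sup>2 - 1 \<and> 0 < \<epsilon>) (at_right 0)"
    by (rule eventually_small_right[OF gap])
  then show ?thesis
  proof eventually_elim
    case (elim \<epsilon>)
    then have \<epsilon>: "\<epsilon> > 0" by simp
    have "\<epsilon>\<^sup>2 * (\<theta> * (l / \<epsilon>)\<^sup>2 - l / \<epsilon> * T / \<rho>) = \<theta> * l\<^sup>2 - \<epsilon> * (l * T / \<rho>)"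
      using \<epsilon> a(1) by (simp add: field_simps power2_eq_square)
    also have "\<theta> * l\<^sup>2 = (1 + t)\<^sup>2" using L(2) by (simp add: l_def power_mult_distrib mult_ac)
    finally have "1 \<le> \<epsilon>\<^sup>2 * (\<theta> * (l / \<epsilon>)\<^sup>2 - l / \<epsilon> * T / \<rho>)" using elim by linarith
    then have "exp (- (l / \<epsilon>) * (norm (x - a) - \<rho>)) \<le> u \<epsilon> x"
      using \<epsilon> l
      by (intro exponential_le_solution[OF assms(1-3) sol[OF \<epsilon>] assms(6) a(1) _ a(2)]) (auto simp: T_def \<theta>_def)
    then have "- (l / \<epsilon>) * (norm (x - a) - \<rho>) \<le> ln (u \<epsilon> x)"
      using pos[OF \<epsilon>] by (simp add: ln_ge_iff)
    then have "\<epsilon> * (- (l / \<epsilon>) * (norm (x - a) - \<rho>)) \<le> \<epsilon> * ln (u \<epsilon> x)"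
      using \<epsilon> by (intro mult_left_mono) auto
    moreover have "\<epsilon> * (- (l / \<epsilon>) * (norm (x - a) - \<rho>)) = - (l * (norm (x - a) - \<rho>))"
      using \<epsilon> by simp
    moreover have "l * (norm (x - a) - \<rho>) \<le> l * (d + t)"
      using xa l by (intro mult_left_mono) auto
    moreover have "c < - (l * (d + t))" using t(1) by (simp add: l_def)
    ultimately show ?case by linarith
  qed
qed

theorem theorem3p6:
  fixes p :: ereal and \<Omega> :: "(real^'n) set" and u :: "real \<Rightarrow> real^'n \<Rightarrow> real"
  assumes "CARD('n) \<ge> 2"
    and "1 < p"
    and "open \<Omega>" and "connected \<Omega>" and "frontier \<Omega> \<noteq> {}"
    and "frontier \<Omega> = frontier (- closure \<Omega>)"
    and "\<And>\<epsilon>. \<epsilon> > 0 \<Longrightarrow> bounded_visc_solution p \<epsilon> \<Omega> (u \<epsilon>)"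
  shows "\<forall>x\<in>closure \<Omega>. (\<forall>\<epsilon>>0. u \<epsilon> x > 0) \<and>
           ((\<lambda>\<epsilon>. \<epsilon> * ln (u \<epsilon> x)) \<longlongrightarrow> - sqrt (conj_exponent p) * infdist x (frontier \<Omega>)) (at_right 0)"
proof
  fix x assume x: "x \<in> closure \<Omega>"
  show "(\<forall>\<epsilon>>0. u \<epsilon> x > 0) \<and>
      ((\<lambda>\<epsilon>. \<epsilon> * ln (u \<epsilon> x)) \<longlongrightarrow> - sqrt (conj_exponent p) * infdist x (frontier \<Omega>)) (at_right 0)"
  proof (cases "x \<in> \<Omega>")
    case True
    have pos: "u \<epsilon> x > 0" if "\<epsilon> > 0" for \<epsilon>
      using solution_pos[OF assms(1-3) assms(7)[OF that] assms(5,6) True that] .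
    then show ?thesis
      using eventually_eps_ln_less[OF assms(1-3,7) pos True] eventually_less_eps_ln[OF assms(1-3,7) pos True assms(5,6)]
      by (intro conjI allI impI order_tendstoI) auto
  next
    case False
    then have fr: "x \<in> frontier \<Omega>" using x \<open>open \<Omega>\<close> by (simp add: frontier_def interior_open)
    then have one: "u \<epsilon> x = 1" if "\<epsilon> > 0" for \<epsilon>
      using assms(7)[OF that] by (simp add: bounded_visc_solution_def)
    have "eventually (\<lambda>\<epsilon>. \<epsilon> * ln (u \<epsilon> x) = 0) (at_right 0)"
      using eventually_at_right_less[of "0::real"] by eventually_elim (simp add: one)
    then show ?thesis using one fr by (simp add: tendsto_eventually)
  qed
qed

end
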